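(* Let $G$ be a finite simple graph. Then $G$ is locally complete 2-edge-colourable if and only if its auxiliary graph $G^+$ is bipartite.
   Context: All graphs are finite and simple. A 2-edge-colouring of a graph $G$ is an arbitrary map $E(G)\to\{1,2\}$ (not necessarily proper). A 2-edge-coloured graph is locally complete if for each vertex $v$ and each colour $c$, the vertices joined to $v$ by edges of colour $c$ induce a complete subgraph of $G$; equivalently, $G$ has no monochromatic induced path with two edges. $G$ is locally complete 2-edge-colourable if it has such a 2-edge-colouring. The auxiliary graph $G^+$ has as vertices the edges of $G$; two vertices of $G^+$ are adjacent if and only if the two corresponding edges of $G$ form an induced path (of length 2) in $G$. *)

theory Defs
  imports Main
begin

record 'a graph =
  verts :: "'a set"
  edges :: "'a set set"

definition finite_simple_graph :: "'a graph \<Rightarrow> bool" where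
  "finite_simple_graph G \<longleftrightarrow>
     finite (verts G) \<and> (\<forall>e \<in> edges G. e \<subseteq> verts G \<and> card e = 2)"

definition induced_subgraph :: "'a graph \<Rightarrow> 'a set \<Rightarrow> 'a graph" where
  "induced_subgraph G S = \<lparr>verts = S \<inter> verts G, edges = {e \<in> edges G. e \<subseteq> S}\<rparr>"

definition complete_graph :: "'a graph \<Rightarrow> bool" where
  "complete_graph G \<longleftrightarrow>
     (\<forall>x \<in> verts G. \<forall>y \<in> verts G. x \<noteq> y \<longrightarrow> {x, y} \<in> edges G)"

text \<open>One of the two parts may be empty.\<close>

definition bipartite :: "'a graph \<Rightarrow> bool" where
  "bipartite G \<longleftrightarrow>
     (\<exists>A B. A \<union> B = verts G \<and> A \<inter> B = {} \<and>
        (\<forall>e \<in> edges G. \<exists>a \<in> A. \<exists>b \<in> B. e = {a, b}))"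

text \<open>Colourings are not required to be proper; values outside the edge set are irrelevant.\<close>

definition two_edge_colouring :: "'a graph \<Rightarrow> ('a set \<Rightarrow> nat) \<Rightarrow> bool" where
  "two_edge_colouring G col \<longleftrightarrow> (\<forall>e \<in> edges G. col e \<in> {1, 2})"

definition colour_neighbours :: "'a graph \<Rightarrow> ('a set \<Rightarrow> nat) \<Rightarrow> nat \<Rightarrow> 'a \<Rightarrow> 'a set" where
  "colour_neighbours G col c v = {u \<in> verts G. {v, u} \<in> edges G \<and> col {v, u} = c}"

definition locally_complete :: "'a graph \<Rightarrow> ('a set \<Rightarrow> nat) \<Rightarrow> bool" where
  "locally_complete G col \<longleftrightarrow>
     (\<forall>v \<in> verts G. \<forall>c \<in> {1, 2}.
        complete_graph (induced_subgraph G (colour_neighbours G col c v)))"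

definition locally_complete_two_edge_colourable :: "'a graph \<Rightarrow> bool" where
  "locally_complete_two_edge_colourable G \<longleftrightarrow>
     (\<exists>col. two_edge_colouring G col \<and> locally_complete G col)"

definition form_induced_path :: "'a graph \<Rightarrow> 'a set \<Rightarrow> 'a set \<Rightarrow> bool" where
  "form_induced_path G e f \<longleftrightarrow>
     (\<exists>u v w. distinct [u, v, w] \<and> e = {u, v} \<and> f = {v, w} \<and>
        induced_subgraph G {u, v, w} = \<lparr>verts = {u, v, w}, edges = {e, f}\<rparr>)"

text \<open>The auxiliary graph \<open>G\<^sup>+\<close>.\<close>

definition aux_graph :: "'a graph \<Rightarrow> 'a set graph" where
  "aux_graph G =
     \<lparr>verts = edges G,
      edges = {{e, f} | e f. e \<in> edges G \<and> f \<in> edges G \<and> form_induced_path G e f}\<rparr>"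

lemma finite_simple_graph_aux_graph:
  assumes "finite_simple_graph G"
  shows "finite_simple_graph (aux_graph G)"
proof -
  have "edges G \<subseteq> Pow (verts G)" and "finite (verts G)"
    using assms by (auto simp: finite_simple_graph_def)
  then have "finite (edges G)"
    by (meson finite_Pow_iff finite_subset)
  moreover have "card {e, f} = 2" if "form_induced_path G e f" for e f
    using that by (auto simp: form_induced_path_def card_2_iff doubleton_eq_iff)
  ultimately show ?thesis
    by (fastforce simp: finite_simple_graph_def aux_graph_def)
qed

end

theory Submission imports Defs begin

text \<open>
  A colouring is locally complete iff no induced path with two edges is monochromatic, i.e. iff
  its two colour classes are independent in \<open>G\<^sup>+\<close>; so they are exactly the bipartitions
  of \<open>G\<^sup>+\<close>.
\<close>

lemma simple_edgeD:
  assumes "finite_simple_graph G" "{u, v} \<in> edges G"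
  shows "u \<noteq> v" "u \<in> verts G" "v \<in> verts G"
  using assms by (fastforce simp: finite_simple_graph_def)+

text \<open>In a simple graph the only candidates for edges inside \<open>{u, v, w}\<close> are the
  three pairs, so the record equation for the induced subgraph amounts to three adjacency facts.
  Writing both edges from the centre \<open>v\<close> matches the shape of
  \<open>colour_neighbours\<close>; that \<open>v\<close> differs from \<open>u\<close> and
  \<open>w\<close> follows from simplicity.\<close>

lemma form_induced_path_iff:
  assumes "finite_simple_graph G"
  shows "form_induced_path G e f \<longleftrightarrow>
    (\<exists>u v w. u \<noteq> w \<and> e = {v, u} \<and> f = {v, w} \<and>
       {v, u} \<in> edges G \<and> {v, w} \<in> edges G \<and> {u, w} \<notin> edges G)"
proof
  assume "form_induced_path G e f"
  then obtain u v w where d: "distinct [u, v, w]" and ef: "e = {v, u}" "f = {v, w}"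
    and E: "{x \<in> edges G. x \<subseteq> {u, v, w}} = {{v, u}, {v, w}}"
    by (auto simp: form_induced_path_def induced_subgraph_def insert_commute)
  have "{v, u} \<in> edges G" "{v, w} \<in> edges G"
    using E by blast+
  moreover have "{u, w} \<notin> edges G"
  proof
    assume "{u, w} \<in> edges G"
    \<comment> \<open>The pair lies inside the three vertices, so as an edge it would have to
      coincide with one of the two path edges.\<close>
    then have "{u, w} \<in> {{v, u}, {v, w}}"
      unfolding E[symmetric] by simp
    with d show False
      by (auto simp: doubleton_eq_iff)
  qed
  ultimately show "\<exists>u v w. u \<noteq> w \<and> e = {v, u} \<and> f = {v, w} \<and>
       {v, u} \<in> edges G \<and> {v, w} \<in> edges G \<and> {u, w} \<notin> edges G"
    using d ef by auto
next
  assume "\<exists>u v w. u \<noteq> w \<and> e = {v, u} \<and> f = {v, w} \<and>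
       {v, u} \<in> edges G \<and> {v, w} \<in> edges G \<and> {u, w} \<notin> edges G"
  then obtain u v w where uw: "u \<noteq> w" and ef: "e = {u, v}" "f = {v, w}"
    and E: "{u, v} \<in> edges G" "{v, w} \<in> edges G" "{u, w} \<notin> edges G"
    by (auto simp: insert_commute)
  note vs = simple_edgeD[OF assms E(1)] simple_edgeD[OF assms E(2)]
  \<comment> \<open>An edge has exactly two elements, so \<open>x\<close> is one of the three pairs,
    and \<open>{u, w}\<close> is ruled out by \<open>E(3)\<close>.\<close>
  have "x \<in> {{u, v}, {v, w}}" if "x \<in> edges G" "x \<subseteq> {u, v, w}" for x
  proof -
    have "card x = 2"
      using assms that by (auto simp: finite_simple_graph_def)
    then obtain a b where "x = {a, b}" "a \<noteq> b"
      by (auto simp: card_2_iff)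
    with that E(3) show ?thesis
      by (auto simp: insert_commute)
  qed
  with E have "{x \<in> edges G. x \<subseteq> {u, v, w}} = {{u, v}, {v, w}}"
    by auto
  moreover have "{u, v, w} \<inter> verts G = {u, v, w}"
    using vs by auto
  ultimately have "induced_subgraph G {u, v, w} = \<lparr>verts = {u, v, w}, edges = {e, f}\<rparr>"
    by (simp add: induced_subgraph_def ef)
  moreover have "distinct [u, v, w]"
    using uw vs by simp
  ultimately show "form_induced_path G e f"
    unfolding form_induced_path_def using ef by blast
qed

text \<open>Two distinct non-adjacent neighbours of \<open>v\<close> reached by edges of the same
  colour are precisely the ends of a monochromatic induced path with centre
  \<open>v\<close>.\<close>

lemma locally_complete_iff_no_monochromatic_path:
  assumes G: "finite_simple_graph G" and col: "two_edge_colouring G col"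
  shows "locally_complete G col \<longleftrightarrow>
    (\<forall>e \<in> edges G. \<forall>f \<in> edges G. form_induced_path G e f \<longrightarrow> col e \<noteq> col f)"
    (is "_ \<longleftrightarrow> ?R")
proof
  assume L: "locally_complete G col"
  show ?R
  proof (intro ballI impI notI)
    fix e f
    assume "form_induced_path G e f" and eq: "col e = col f"
    then obtain u v w where p: "u \<noteq> w" "e = {v, u}" "f = {v, w}"
      "{v, u} \<in> edges G" "{v, w} \<in> edges G" "{u, w} \<notin> edges G"
      unfolding form_induced_path_iff[OF G] by blast
    \<comment> \<open>\<open>locally_complete\<close> quantifies over colours 1 and 2 only, so the
      common colour of the path must be one of them before it can be instantiated.\<close>
    have "col {v, u} \<in> {1, 2}"
      using col p by (auto simp: two_edge_colouring_def)
    then have "complete_graph (induced_subgraph G (colour_neighbours G col (col {v, u}) v))"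
      using L simple_edgeD(2)[OF G p(4)] by (simp only: locally_complete_def)
    moreover have "u \<in> colour_neighbours G col (col {v, u}) v"
      "w \<in> colour_neighbours G col (col {v, u}) v"
      using p eq simple_edgeD(3)[OF G p(4)] simple_edgeD(3)[OF G p(5)]
      by (auto simp: colour_neighbours_def)
    ultimately have "{u, w} \<in> edges G"
      using p(1) by (auto simp: complete_graph_def induced_subgraph_def colour_neighbours_def)
    with p show False by simp
  qed
next
  assume R: ?R
  \<comment> \<open>This is local completeness at \<open>v\<close> with the colour eliminated:
    membership in one colour neighbourhood becomes equality of two edge colours.\<close>
  have "{u, w} \<in> edges G"
    if "u \<noteq> w" "{v, u} \<in> edges G" "{v, w} \<in> edges G" "col {v, u} = col {v, w}" for u v w
  proof (rule ccontr)
    assume "{u, w} \<notin> edges G"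
    with that have "form_induced_path G {v, u} {v, w}"
      unfolding form_induced_path_iff[OF G] by blast
    with R that show False by blast
  qed
  then show "locally_complete G col"
    by (auto simp: locally_complete_def complete_graph_def induced_subgraph_def
        colour_neighbours_def)
qed

theorem theorem1:
  fixes G :: "'a graph"
  assumes "finite_simple_graph G"
  shows "locally_complete_two_edge_colourable G \<longleftrightarrow> bipartite (aux_graph G)"
proof
  assume "locally_complete_two_edge_colourable G"
  then obtain col where col: "two_edge_colouring G col" and L: "locally_complete G col"
    by (auto simp: locally_complete_two_edge_colourable_def)
  define A where "A = {e \<in> edges G. col e = 1}"
  define B where "B = {e \<in> edges G. col e = 2}"
  have "\<exists>a \<in> A. \<exists>b \<in> B. x = {a, b}" if "x \<in> edges (aux_graph G)" for x
  proof -
    obtain e f where ef: "x = {e, f}" "e \<in> edges G" "f \<in> edges G" "form_induced_path G e f"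
      using \<open>x \<in> edges (aux_graph G)\<close> by (auto simp: aux_graph_def)
    then have "col e \<noteq> col f" "col e \<in> {1, 2}" "col f \<in> {1, 2}"
      using L col unfolding locally_complete_iff_no_monochromatic_path[OF assms col]
      by (auto simp: two_edge_colouring_def)
    \<comment> \<open>Two different values in \<open>{1, 2}\<close> are 1 and 2 in some order; the
      order is immaterial because \<open>x\<close> is an unordered pair.\<close>
    then have "e \<in> A \<and> f \<in> B \<or> f \<in> A \<and> e \<in> B"
      using ef by (auto simp: A_def B_def)
    with ef(1) show ?thesis
      by (blast intro: insert_commute)
  qed
  moreover have "A \<union> B = verts (aux_graph G)" "A \<inter> B = {}"
    using col by (auto simp: A_def B_def aux_graph_def two_edge_colouring_def)
  ultimately show "bipartite (aux_graph G)"
    unfolding bipartite_def by blast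
next
  assume "bipartite (aux_graph G)"
  then obtain A B where AB: "A \<inter> B = {}"
    and E: "\<forall>x \<in> edges (aux_graph G). \<exists>a \<in> A. \<exists>b \<in> B. x = {a, b}"
    unfolding bipartite_def by (elim exE conjE)
  \<comment> \<open>The default 2 covers \<open>B\<close> as well as sets that are not edges, so
    every value lies in \<open>{1, 2}\<close> by construction.\<close>
  define col :: "'a set \<Rightarrow> nat" where "col e = (if e \<in> A then 1 else 2)" for e
  have col: "two_edge_colouring G col"
    by (simp add: two_edge_colouring_def col_def)
  have "col e \<noteq> col f" if "e \<in> edges G" "f \<in> edges G" "form_induced_path G e f" for e f
  proof -
    have ef: "{e, f} \<in> edges (aux_graph G)"
      using that unfolding aux_graph_def by simp blast
    then obtain a b where "a \<in> A" "b \<in> B" "{e, f} = {a, b}"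
      using bspec[OF E ef] by (elim bexE)
    \<comment> \<open>Either of \<open>e\<close> and \<open>f\<close> may be the end in
      \<open>A\<close>; the other lies in \<open>B\<close>, hence outside \<open>A\<close> by
      disjointness, and receives 2.\<close>
    then show ?thesis
      using AB by (auto simp: col_def doubleton_eq_iff)
  qed
  then have "locally_complete G col"
    unfolding locally_complete_iff_no_monochromatic_path[OF assms col] by blast
  with col show "locally_complete_two_edge_colourable G"
    by (auto simp: locally_complete_two_edge_colourable_def)
qed

end
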